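(* Let $(X,d)$ be a compact metric space, let $f:X\to X$ be a continuous surjection, and let $\mathbb{F}=(f_n)_{n\in\mathbb{N}}$ be a sequence of feeble open continuous surjections $f_n:X\to X$ such that $f_n\circ f=f\circ f_n$ for every $n\in\mathbb{N}$. If $\sum_{n=1}^{\infty} D(f_n,f)<\infty$, then $(X,f)$ is cofinitely sensitive if and only if $(X,\mathbb{F})$ is cofinitely sensitive.
   Context: $D(g,h)=\sup_{x\in X}d(g(x),h(x))$ for continuous self maps $g,h$ of $X$. A map $g:X\to X$ is feeble open if $\mathrm{int}(g(U))\neq\emptyset$ for every non-empty open $U\subset X$. For $\mathbb{F}=(f_n)_{n\in\mathbb{N}}$ (with $\mathbb{N}=\{1,2,\dots\}$), put $\omega_n=f_n\circ f_{n-1}\circ\cdots\circ f_1$; $(X,\mathbb{F})$ denotes the non-autonomous system with orbits $\{\omega_n(x):n\in\mathbb{N}\}$. $(X,\mathbb{F})$ is cofinitely sensitive if there is $\delta>0$ such that for each $x\in X$ and each neighborhood $U$ of $x$ there is $K>0$ with $\mathrm{diam}(\omega_n(U))>\delta$ for all $n\ge K$. $(X,f)$ is cofinitely sensitive if the same holds with $\omega_n$ replaced by $f^n$. *)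

theory Defs
  imports "HOL-Analysis.Analysis"
begin

text \<open>
  The phase space is a set \<open>X\<close> in a type of class \<^class>\<open>metric_space\<close>, with the
  metric restricted to \<open>X\<close>.  Self maps of \<open>X\<close> are total functions whose values matter
  on \<open>X\<close> only; openness, interiors and neighbourhoods are relative to \<open>X\<close>.
\<close>

definition sup_dist :: "'a::metric_space set \<Rightarrow> ('a \<Rightarrow> 'a) \<Rightarrow> ('a \<Rightarrow> 'a) \<Rightarrow> real" where
  "sup_dist X g h = (SUP x\<in>X. dist (g x) (h x))"

definition feeble_open :: "'a::metric_space set \<Rightarrow> ('a \<Rightarrow> 'a) \<Rightarrow> bool" where
  "feeble_open X g \<longleftrightarrow>
     (\<forall>U. openin (top_of_set X) U \<and> U \<noteq> {} \<longrightarrow> (top_of_set X) interior_of (g ` U) \<noteq> {})"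

definition nbhd :: "'a::metric_space set \<Rightarrow> 'a \<Rightarrow> 'a set \<Rightarrow> bool" where
  "nbhd X x U \<longleftrightarrow> U \<subseteq> X \<and> x \<in> (top_of_set X) interior_of U"

text \<open>Sequences of maps are indexed from 1; the entry \<open>F 0\<close> is never used.\<close>

primrec omega :: "(nat \<Rightarrow> 'a \<Rightarrow> 'a) \<Rightarrow> nat \<Rightarrow> 'a \<Rightarrow> 'a" where
  "omega F 0 = id"
| "omega F (Suc n) = F (Suc n) \<circ> omega F n"

definition cofinitely_sensitive_iterates ::
    "'a::metric_space set \<Rightarrow> (nat \<Rightarrow> 'a \<Rightarrow> 'a) \<Rightarrow> bool" where
  "cofinitely_sensitive_iterates X w \<longleftrightarrow>
     (\<exists>\<delta>>0. \<forall>x\<in>X. \<forall>U. nbhd X x U \<longrightarrow>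
        (\<exists>K>0. \<forall>n\<ge>K. diameter (w n ` U) > \<delta>))"

definition cofinitely_sensitive_nonautonomous ::
    "'a::metric_space set \<Rightarrow> (nat \<Rightarrow> 'a \<Rightarrow> 'a) \<Rightarrow> bool" where
  "cofinitely_sensitive_nonautonomous X F \<longleftrightarrow> cofinitely_sensitive_iterates X (omega F)"

definition cofinitely_sensitive :: "'a::metric_space set \<Rightarrow> ('a \<Rightarrow> 'a) \<Rightarrow> bool" where
  "cofinitely_sensitive X f \<longleftrightarrow> cofinitely_sensitive_iterates X (\<lambda>n. f ^^ n)"

end

theory Submission
  imports Defs
begin

text \<open>
  Since \<open>f\<close> commutes with every \<open>f\<^sub>i\<close>, the maps in \<open>f\<^sub>k\<^sub>+\<^sub>n \<circ> \<dots> \<circ> f\<^sub>k\<^sub>+\<^sub>1\<close> can be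
  replaced by \<open>f\<close> one at a time from the outside: each new factor \<open>f\<close> moves to the
  innermost position, so the errors add up without being amplified, and the composition
  is within \<open>\<Sum>\<^sub>i\<^sub>>\<^sub>k D(f\<^sub>i, f)\<close> of \<open>f\<^sup>n\<close>, uniformly in \<open>n\<close>.  Choose \<open>k\<close> so that this tail
  is small compared with the sensitivity constant.  It remains to pass through the first
  \<open>k\<close> maps: a neighbourhood is pulled back by the continuous surjection \<open>\<omega>\<^sub>k\<close> in one
  direction, and pushed forward by the feeble open map \<open>\<omega>\<^sub>k\<close> in the other.
\<close>

lemma dist_le_sup_dist:
  assumes "bounded X" "g ` X \<subseteq> X" "h ` X \<subseteq> X" "x \<in> X"
  shows "dist (g x) (h x) \<le> sup_dist X g h"
  unfolding sup_dist_def
proof (rule cSUP_upper)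
  show "bdd_above ((\<lambda>x. dist (g x) (h x)) ` X)"
    using assms by (intro bdd_aboveI[of _ "diameter X"]) (auto intro!: diameter_bounded_bound)
qed fact

lemma sup_dist_nonneg:
  assumes "bounded X" "g ` X \<subseteq> X" "h ` X \<subseteq> X" "X \<noteq> {}"
  shows "0 \<le> sup_dist X g h"
proof -
  obtain x where "x \<in> X" using assms by blast
  then show ?thesis
    using dist_le_sup_dist[OF assms(1-3), of x] by (meson order_trans zero_le_dist)
qed

text \<open>Each of the two endpoints moves by at most \<open>e\<close>, hence the factor 2.
  Boundedness is required only of the image on the right: the left-hand diameter is bounded pair by
  pair, as a least upper bound.\<close>

lemma diameter_image_perturb:
  fixes g h :: "'a \<Rightarrow> 'b::metric_space"
  assumes "bounded (h ` S)" "\<And>x. x \<in> S \<Longrightarrow> dist (g x) (h x) \<le> e" "0 \<le> e"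
  shows "diameter (g ` S) \<le> diameter (h ` S) + 2 * e"
proof (cases "S = {}")
  case False
  have "dist (g x) (g y) \<le> diameter (h ` S) + 2 * e" if "x \<in> S" "y \<in> S" for x y
  proof -
    have "dist (g x) (g y) \<le> dist (g x) (h x) + dist (h x) (h y) + dist (g y) (h y)"
      by metric
    moreover have "dist (h x) (h y) \<le> diameter (h ` S)"
      using assms that by (intro diameter_bounded_bound) auto
    ultimately show ?thesis
      using assms(2)[of x] assms(2)[of y] that by linarith
  qed
  with False show ?thesis
    by (auto simp: diameter_def intro!: cSUP_least)
qed (use assms in simp)

lemma omega_add: "omega F (k + n) = omega (\<lambda>i. F (k + i)) n \<circ> omega F k"
  by (induction n) (auto simp: fun_eq_iff)

lemma omega_image:
  assumes "\<And>n. n \<ge> 1 \<Longrightarrow> F n ` X = X"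
  shows "omega F n ` X = X"
proof (induction n)
  case (Suc n)
  then have "omega F (Suc n) ` X = F (Suc n) ` X"
    by (metis image_comp omega.simps(2))
  then show ?case by (simp add: assms)
qed simp

lemma continuous_on_omega:
  assumes "\<And>n. n \<ge> 1 \<Longrightarrow> F n ` X = X" "\<And>n. n \<ge> 1 \<Longrightarrow> continuous_on X (F n)"
  shows "continuous_on X (omega F n)"
proof (induction n)
  case (Suc n)
  have "omega F n ` X = X" using assms(1) by (rule omega_image)
  with Suc show ?case
    unfolding omega.simps by (intro continuous_on_compose) (auto intro: assms(2))
qed (simp add: id_def)

lemma feeble_open_id: "feeble_open X id"
  by (auto simp: feeble_open_def interior_of_openin)

lemma feeble_open_comp:
  assumes "feeble_open X g" "feeble_open X h"
  shows "feeble_open X (g \<circ> h)"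
  unfolding feeble_open_def
proof (intro allI impI, elim conjE)
  fix U assume U: "openin (top_of_set X) U" "U \<noteq> {}"
  define W where "W = (top_of_set X) interior_of (h ` U)"
  have "(top_of_set X) interior_of (g ` W) \<noteq> {}"
    using assms U unfolding feeble_open_def W_def by (meson openin_interior_of)
  moreover have "g ` W \<subseteq> (g \<circ> h) ` U"
    using interior_of_subset[of "top_of_set X" "h ` U"] by (auto simp: W_def)
  ultimately show "(top_of_set X) interior_of ((g \<circ> h) ` U) \<noteq> {}"
    using interior_of_mono by blast
qed

lemma feeble_open_omega:
  assumes "\<And>n. n \<ge> 1 \<Longrightarrow> feeble_open X (F n)"
  shows "feeble_open X (omega F n)"
proof (induction n)
  case (Suc n)
  then show ?case
    unfolding omega.simps by (intro feeble_open_comp assms) auto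
qed (unfold omega.simps, rule feeble_open_id)

lemma dist_omega_funpow_le:
  assumes "bounded X" "f ` X = X" "\<And>n. n \<ge> 1 \<Longrightarrow> F n ` X = X"
    and comm: "\<And>n x. n \<ge> 1 \<Longrightarrow> x \<in> X \<Longrightarrow> F n (f x) = f (F n x)"
    and "x \<in> X"
  shows "dist (omega F n x) ((f ^^ n) x) \<le> (\<Sum>i<n. sup_dist X (F (Suc i)) f)"
  using \<open>x \<in> X\<close>
\<comment> \<open>The point varies because the induction hypothesis is used at \<open>f x\<close>,
  where the innermost \<open>f\<close> has already acted.\<close>
proof (induction n arbitrary: x)
  case (Suc n)
  have inX: "omega F m x \<in> X" for m
    using omega_image[where F = F and n = m, OF assms(3)] Suc.prems by blast
  \<comment> \<open>Commutation is assumed on \<open>X\<close> only, so moving \<open>f\<close> past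
    the factors one by one relies on \<open>inX\<close>.\<close>
  have shift: "omega F m (f x) = f (omega F m x)" for m
    by (induction m) (simp_all add: comm inX)
  have "dist (F (Suc n) (omega F n x)) (f (omega F n x)) \<le> sup_dist X (F (Suc n)) f"
    using assms inX by (intro dist_le_sup_dist) auto
  moreover have "dist (omega F n (f x)) ((f ^^ n) (f x)) \<le> (\<Sum>i<n. sup_dist X (F (Suc i)) f)"
    using Suc assms(2) by blast
  moreover have "dist (F (Suc n) (omega F n x)) ((f ^^ n) (f x)) \<le>
      dist (F (Suc n) (omega F n x)) (f (omega F n x)) + dist (omega F n (f x)) ((f ^^ n) (f x))"
    unfolding shift by (rule dist_triangle)
  ultimately show ?case
    by (simp add: funpow_swap1)
qed simp

lemma nbhd_vimage:
  assumes "continuous_on X g" "g ` X \<subseteq> X" "y \<in> X" "nbhd X (g y) U"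
  shows "nbhd X y (X \<inter> g -` U)"
proof -
  define W where "W = (top_of_set X) interior_of U"
  have "openin (top_of_set X) (X \<inter> g -` W)"
    using assms(1,2) by (intro continuous_openin_preimage[of X g X]) (auto simp: W_def)
  moreover have "X \<inter> g -` W \<subseteq> X \<inter> g -` U"
    using interior_of_subset[of "top_of_set X" U] by (auto simp: W_def)
  moreover have "y \<in> X \<inter> g -` W"
    using assms(3,4) by (simp add: W_def nbhd_def)
  ultimately show ?thesis
    using interior_of_maximal unfolding nbhd_def by blast
qed

lemma nbhd_openin: "openin (top_of_set X) W \<Longrightarrow> x \<in> W \<Longrightarrow> nbhd X x W"
  by (simp add: nbhd_def interior_of_openin openin_imp_subset)

theorem corollary7:
  fixes X :: "'a::metric_space set"
    and f :: "'a \<Rightarrow> 'a"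
    and F :: "nat \<Rightarrow> 'a \<Rightarrow> 'a"
  assumes "compact X"
    and "continuous_on X f" and "f ` X = X"
    and "\<And>n. n \<ge> 1 \<Longrightarrow> feeble_open X (F n)"
    and "\<And>n. n \<ge> 1 \<Longrightarrow> continuous_on X (F n)"
    and "\<And>n. n \<ge> 1 \<Longrightarrow> F n ` X = X"
    and "\<And>n x. n \<ge> 1 \<Longrightarrow> x \<in> X \<Longrightarrow> F n (f x) = f (F n x)"
    and "summable (\<lambda>n. sup_dist X (F (Suc n)) f)"
  shows "cofinitely_sensitive X f \<longleftrightarrow> cofinitely_sensitive_nonautonomous X F"
proof (cases "X = {}")
  \<comment> \<open>The empty space is split off because \<open>sup_dist\<close> would be a supremum
    over the empty set, whose sign is not controlled. Both sides then hold vacuously.\<close>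
  case True
  then show ?thesis
    by (auto simp: cofinitely_sensitive_def cofinitely_sensitive_nonautonomous_def
        cofinitely_sensitive_iterates_def intro: exI[of _ 1])
next
  case False
  have bdd: "bounded X"
    using \<open>compact X\<close> by (rule compact_imp_bounded)
  \<comment> \<open>Diameters are suprema of reals, so comparing them requires bounded sets; all
    images below stay in the compact \<open>X\<close>.\<close>
  have bdd_image: "bounded (g ` S)" if "g ` X = X" "S \<subseteq> X" for g :: "'a \<Rightarrow> 'a" and S
    using bounded_subset[OF bdd, of "g ` S"] image_mono[of S X g] that by simp
  have omX: "omega F n ` X = X" for n
    using assms(6) by (rule omega_image)
  have fX: "(f ^^ n) ` X = X" for n
  proof (induction n)
    case (Suc n)
    then show ?case by (metis \<open>f ` X = X\<close> funpow.simps(2) image_comp)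
  qed simp
  have tailX: "omega (\<lambda>i. F (k + i)) n ` X = X" for k n
    by (rule omega_image) (simp add: assms(6))
  have tail: "\<exists>k. \<forall>n. \<forall>x\<in>X. dist (omega (\<lambda>i. F (k + i)) n x) ((f ^^ n) x) \<le> e"
    if e: "0 < e" for e
  proof -
    let ?s = "\<lambda>i. sup_dist X (F (Suc i)) f"
    have nonneg: "0 \<le> ?s i" for i
      using assms False bdd by (intro sup_dist_nonneg) auto
    obtain k where k: "\<bar>\<Sum>i. ?s (i + k)\<bar> < e"
      using suminf_exist_split[OF e assms(8)] by auto
    have "dist (omega (\<lambda>i. F (k + i)) n x) ((f ^^ n) x) \<le> e" if "x \<in> X" for n x
    proof -
      \<comment> \<open>The shifted sequence inherits surjectivity and commutation with
        \<open>f\<close>, so the estimate applies to it; \<open>k\<close> was fixed before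
        \<open>n\<close> and \<open>x\<close>.\<close>
      have "dist (omega (\<lambda>i. F (k + i)) n x) ((f ^^ n) x) \<le> (\<Sum>i<n. sup_dist X (F (k + Suc i)) f)"
        using assms bdd that by (intro dist_omega_funpow_le) auto
      also have "\<dots> = (\<Sum>i<n. ?s (i + k))"
        by (simp add: add.commute)
      also have "\<dots> \<le> (\<Sum>i. ?s (i + k))"
        using assms(8) nonneg by (intro sum_le_suminf) (auto simp: summable_iff_shift[of ?s])
      finally show ?thesis using k by linarith
    qed
    then show ?thesis by blast
  qed
  show ?thesis
    unfolding cofinitely_sensitive_def cofinitely_sensitive_nonautonomous_def
  proof
    assume "cofinitely_sensitive_iterates X (\<lambda>n. f ^^ n)"
    then obtain \<delta> where "\<delta> > 0" and \<delta>: "\<And>x U. x \<in> X \<Longrightarrow> nbhd X x U \<Longrightarrow>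
        \<exists>K>0. \<forall>n\<ge>K. diameter ((f ^^ n) ` U) > \<delta>"
      unfolding cofinitely_sensitive_iterates_def by blast
    \<comment> \<open>With error \<delta>/4 at each endpoint the diameter changes by at most
      \<delta>/2, which leaves \<delta>/2 as the new sensitivity constant. The converse uses the
      same choice.\<close>
    obtain k where k: "\<And>n x. x \<in> X \<Longrightarrow>
        dist (omega (\<lambda>i. F (k + i)) n x) ((f ^^ n) x) \<le> \<delta> / 4"
      using tail[of "\<delta> / 4"] \<open>\<delta> > 0\<close> by auto
    have "\<exists>K>0. \<forall>n\<ge>K. diameter (omega F n ` U) > \<delta> / 2" if "nbhd X x U" for x U
    proof -
      \<comment> \<open>The inner interior makes feeble openness applicable; the outer one makes
        \<open>W\<close> a neighbourhood of each of its points. The image of \<open>x\<close> may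
        lie outside \<open>W\<close>, but any \<open>z\<close> in \<open>W\<close> will do, since
        \<delta> is the same at all points.\<close>
      define W where "W = (top_of_set X) interior_of (omega F k ` ((top_of_set X) interior_of U))"
      have "feeble_open X (omega F k)"
        using assms(4) by (rule feeble_open_omega)
      moreover have "(top_of_set X) interior_of U \<noteq> {}"
        using that by (auto simp: nbhd_def)
      ultimately have "W \<noteq> {}"
        unfolding W_def feeble_open_def using openin_interior_of by blast
      then obtain z where "z \<in> W" by blast
      have "openin (top_of_set X) W" by (simp add: W_def)
      then have "W \<subseteq> X" by (rule openin_imp_subset)
      have "W \<subseteq> omega F k ` U"
        using interior_of_subset unfolding W_def by (metis image_mono order_trans)
      obtain K where "K > 0" and K: "\<And>n. n \<ge> K \<Longrightarrow> diameter ((f ^^ n) ` W) > \<delta>"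
        using \<delta>[of z W] nbhd_openin[OF \<open>openin _ W\<close> \<open>z \<in> W\<close>] \<open>z \<in> W\<close> \<open>W \<subseteq> X\<close> by auto
      \<comment> \<open>The first \<open>k\<close> maps carry \<open>U\<close> onto a superset of
        \<open>W\<close>, so only the remaining \<open>n - k\<close> steps are compared with
        iterates of \<open>f\<close>.\<close>
      have "diameter (omega F n ` U) > \<delta> / 2" if "n \<ge> k + K" for n
      proof -
        define m where "m = n - k"
        then have n: "n = k + m" and "m \<ge> K"
          using that by auto
        let ?g = "omega (\<lambda>i. F (k + i)) m"
        have "diameter ((f ^^ m) ` W) \<le> diameter (?g ` W) + 2 * (\<delta> / 4)"
        proof (rule diameter_image_perturb)
          show "bounded (?g ` W)" using tailX \<open>W \<subseteq> X\<close> by (rule bdd_image)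
          show "dist ((f ^^ m) y) (?g y) \<le> \<delta> / 4" if "y \<in> W" for y
            using k \<open>W \<subseteq> X\<close> that by (metis dist_commute subsetD)
        qed (use \<open>\<delta> > 0\<close> in simp)
        moreover have "diameter (?g ` W) \<le> diameter (omega F n ` U)"
        proof (rule diameter_subset)
          show "?g ` W \<subseteq> omega F n ` U"
            using \<open>W \<subseteq> omega F k ` U\<close> by (auto simp: n omega_add)
          show "bounded (omega F n ` U)"
            using \<open>nbhd X x U\<close> by (intro bdd_image omX) (simp add: nbhd_def)
        qed
        ultimately show ?thesis using K[OF \<open>m \<ge> K\<close>] by linarith
      qed
      then show ?thesis using \<open>K > 0\<close> by (intro exI[of _ "k + K"]) auto
    qed
    then show "cofinitely_sensitive_iterates X (omega F)"
      unfolding cofinitely_sensitive_iterates_def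
      using \<open>\<delta> > 0\<close> by (intro exI[of _ "\<delta> / 2"]) auto
  next
    assume "cofinitely_sensitive_iterates X (omega F)"
    then obtain \<delta> where "\<delta> > 0" and \<delta>: "\<And>x U. x \<in> X \<Longrightarrow> nbhd X x U \<Longrightarrow>
        \<exists>K>0. \<forall>n\<ge>K. diameter (omega F n ` U) > \<delta>"
      unfolding cofinitely_sensitive_iterates_def by blast
    obtain k where k: "\<And>n x. x \<in> X \<Longrightarrow>
        dist (omega (\<lambda>i. F (k + i)) n x) ((f ^^ n) x) \<le> \<delta> / 4"
      using tail[of "\<delta> / 4"] \<open>\<delta> > 0\<close> by auto
    have "\<exists>K>0. \<forall>n\<ge>K. diameter ((f ^^ n) ` U) > \<delta> / 2" if "x \<in> X" "nbhd X x U" for x U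
    proof -
      have "x \<in> omega F k ` X"
        using omX \<open>x \<in> X\<close> by simp
      then obtain y where "y \<in> X" and y: "omega F k y = x"
        by (elim imageE) simp
      \<comment> \<open>After \<open>k\<close> steps \<open>V\<close> lands inside \<open>U\<close>,
        so spreading of \<open>V\<close> at time \<open>k + n\<close> forces spreading of
        \<open>U\<close> under the \<open>n\<close> maps that follow.\<close>
      define V where "V = X \<inter> omega F k -` U"
      have "nbhd X y V"
        unfolding V_def using omX \<open>y \<in> X\<close> y \<open>nbhd X x U\<close>
        by (intro nbhd_vimage continuous_on_omega assms(5,6)) auto
      then obtain K where "K > 0" and K: "\<And>n. n \<ge> K \<Longrightarrow> diameter (omega F n ` V) > \<delta>"
        using \<delta> \<open>y \<in> X\<close> by blast
      have "U \<subseteq> X" using \<open>nbhd X x U\<close> by (simp add: nbhd_def)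
      \<comment> \<open>The threshold \<open>K\<close> carries over unchanged: sensitivity is used
        at time \<open>k + n\<close>, which is at least \<open>K\<close> as well.\<close>
      have "diameter ((f ^^ n) ` U) > \<delta> / 2" if "n \<ge> K" for n
      proof -
        let ?g = "omega (\<lambda>i. F (k + i)) n"
        have "diameter (omega F (k + n) ` V) \<le> diameter (?g ` U)"
        proof (rule diameter_subset)
          show "omega F (k + n) ` V \<subseteq> ?g ` U"
            by (auto simp: V_def omega_add)
          show "bounded (?g ` U)"
            using tailX \<open>U \<subseteq> X\<close> by (rule bdd_image)
        qed
        moreover have "diameter (?g ` U) \<le> diameter ((f ^^ n) ` U) + 2 * (\<delta> / 4)"
        proof (rule diameter_image_perturb)
          show "bounded ((f ^^ n) ` U)" using fX \<open>U \<subseteq> X\<close> by (rule bdd_image)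
          show "dist (?g y) ((f ^^ n) y) \<le> \<delta> / 4" if "y \<in> U" for y
            using k \<open>U \<subseteq> X\<close> that by blast
        qed (use \<open>\<delta> > 0\<close> in simp)
        ultimately show ?thesis using K[of "k + n"] that by linarith
      qed
      then show ?thesis using \<open>K > 0\<close> by blast
    qed
    then show "cofinitely_sensitive_iterates X (\<lambda>n. f ^^ n)"
      unfolding cofinitely_sensitive_iterates_def
      using \<open>\<delta> > 0\<close> by (intro exI[of _ "\<delta> / 2"]) auto
  qed
qed

end
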